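(* Let $\mu$ be the Möbius function and, for $\alpha\in\mathbb R$, let $$F(\alpha)=\Big\{x\in\{-1,1\}^{\mathbb N}:\ \lim_{N\to\infty}\frac1N\sum_{n=1}^N\mu(n)x_nx_{n+1}=\alpha\Big\}.$$ For every $\alpha\in(-6/\pi^2,6/\pi^2)$, $$\dim F(\alpha)=1-\frac6{\pi^2}+\frac6{\pi^2\log2}\,H\Big(\frac12+\frac{\pi^2}{12}\alpha\Big),$$ where $H(x)=-x\log x-(1-x)\log(1-x)$.
   Context: Points of $\{-1,1\}^{\mathbb N}$ are sequences $x=(x_n)_{n\ge0}$. $\dim$ is Hausdorff dimension with respect to the metric $d(x,y)=2^{-n}$, where $n$ is the least $k$ with $x_k\ne y_k$ (and $d(x,x)=0$). $\log$ is the natural logarithm. *)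

theory Defs
  imports "HOL-Analysis.Analysis" "HOL-Computational_Algebra.Squarefree"
begin

definition moebius_mu :: "nat \<Rightarrow> int" where
  "moebius_mu n = (if squarefree n then (-1) ^ card (prime_factors n) else 0)"

context Metric_space
begin

text \<open>
  Carrier-based version of the library's \<open>diameter\<close>. It is only meaningful for bounded sets; in
  \<open>hausdorff_premeasure\<close> it is only applied to sets whose pairwise distances are at most \<open>\<delta>\<close>.
\<close>
definition set_diameter :: "'a set \<Rightarrow> real" where
  "set_diameter S = (if S = {} then 0 else SUP (x, y)\<in>S \<times> S. d x y)"

text \<open>
  The cases reflect that the empty set contributes nothing and that \<open>0\<^sup>0 = 1\<close>,
  whereas \<open>0 powr 0 = 0\<close> in HOL.
\<close>
definition diameter_power :: "real \<Rightarrow> 'a set \<Rightarrow> ennreal" where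
  "diameter_power s S =
     (if S = {} then 0 else if s = 0 then 1 else ennreal (set_diameter S powr s))"

definition hausdorff_premeasure :: "real \<Rightarrow> real \<Rightarrow> 'a set \<Rightarrow> ennreal" where
  "hausdorff_premeasure s \<delta> A =
     (INF U \<in> {U :: nat \<Rightarrow> 'a set.
          A \<subseteq> (\<Union>i. U i) \<and> (\<forall>i. U i \<subseteq> M \<and> (\<forall>x\<in>U i. \<forall>y\<in>U i. d x y \<le> \<delta>))}.
        (\<Sum>i. diameter_power s (U i)))"

definition hausdorff_measure :: "real \<Rightarrow> 'a set \<Rightarrow> ennreal" where
  "hausdorff_measure s A = (SUP \<delta>\<in>{0<..}. hausdorff_premeasure s \<delta> A)"

text \<open>Extended-real valued, so that the dimension is \<open>\<infinity>\<close> when no exponent \<open>s\<close> qualifies.\<close>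
definition hausdorff_dim :: "'a set \<Rightarrow> ereal" where
  "hausdorff_dim A = (INF s\<in>{s. 0 \<le> s \<and> hausdorff_measure s A = 0}. ereal s)"

end

definition sign_seqs :: "(nat \<Rightarrow> int) set" where
  "sign_seqs = UNIV \<rightarrow> {-1, 1}"

definition seq_dist :: "(nat \<Rightarrow> int) \<Rightarrow> (nat \<Rightarrow> int) \<Rightarrow> real" where
  "seq_dist x y = (if x = y then 0 else (1/2) ^ (LEAST k. x k \<noteq> y k))"

lemma Metric_space_sign_seqs: "Metric_space sign_seqs seq_dist"
proof
  fix x y z :: "nat \<Rightarrow> int"
  show "0 \<le> seq_dist x y"
    by (simp add: seq_dist_def)
  have "(LEAST k. x k \<noteq> y k) = (LEAST k. y k \<noteq> x k)"
    by (rule arg_cong[where f = Least]) auto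
  then show "seq_dist x y = seq_dist y x"
    by (cases "x = y") (simp_all add: seq_dist_def)
  show "seq_dist x y = 0 \<longleftrightarrow> x = y"
    by (simp add: seq_dist_def)
  show "seq_dist x z \<le> seq_dist x y + seq_dist y z"
  proof (cases "x = z \<or> x = y \<or> y = z")
    case True
    then show ?thesis
      by (elim disjE) (simp_all add: seq_dist_def)
  next
    case False
    let ?l = "LEAST k. x k \<noteq> z k"
    let ?m = "LEAST k. x k \<noteq> y k"
    let ?n = "LEAST k. y k \<noteq> z k"
    have "\<exists>k. x k \<noteq> z k"
      using False by (simp add: fun_eq_iff)
    then have "x ?l \<noteq> z ?l"
      by (rule LeastI_ex)
    then have "x ?l \<noteq> y ?l \<or> y ?l \<noteq> z ?l"
      by metis
    then have "?m \<le> ?l \<or> ?n \<le> ?l"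
      by (metis (mono_tags, lifting) Least_le)
    then have "(1/2::real) ^ ?l \<le> (1/2) ^ ?m \<or> (1/2::real) ^ ?l \<le> (1/2) ^ ?n"
      by (elim disjE) (simp_all add: power_decreasing)
    moreover have "0 \<le> (1/2::real) ^ ?m" "0 \<le> (1/2::real) ^ ?n"
      by simp_all
    ultimately have "(1/2::real) ^ ?l \<le> (1/2) ^ ?m + (1/2) ^ ?n"
      by linarith
    then show ?thesis
      using False by (simp add: seq_dist_def)
  qed
qed

definition moebius_level_set :: "real \<Rightarrow> (nat \<Rightarrow> int) set" where
  "moebius_level_set \<alpha> =
     {x \<in> sign_seqs.
        (\<lambda>N. 1 / real N * real_of_int (\<Sum>n=1..N. moebius_mu n * x n * x (n + 1))) \<longlonglongrightarrow> \<alpha>}"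

definition binary_entropy :: "real \<Rightarrow> real" where
  "binary_entropy x = - x * ln x - (1 - x) * ln (1 - x)"

end

theory Submission
  imports Defs "HOL-Probability.Probability"
begin

text \<open>
  Fixing \<open>x\<^sub>0\<close>, a sequence \<open>x\<close> is determined by the signs \<open>\<mu>(n) x\<^sub>n x\<^sub>n\<^sub>+\<^sub>1\<close> at squarefree \<open>n\<close> and by
  \<open>x\<^sub>n\<^sub>+\<^sub>1\<close> at the other \<open>n\<close>. Choose the former independently with bias \<open>p = 1/2 + \<pi>\<^sup>2\<alpha>/12\<close> and the
  latter by fair coins. As squarefree numbers have density \<open>6/\<pi>\<^sup>2\<close>, the strong law of large numbers
  shows that the resulting law is carried by the level set. The logarithm of the probability of a
  prefix of \<open>x\<close> is an affine function of its length, of the number of squarefree integers below that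
  length and of the sum defining the level set, so the law has the same local dimension at every point of
  the level set, and Billingsley's argument identifies that value with the Hausdorff dimension.
\<close>

section \<open>The density of squarefree numbers\<close>

definition squarefree_count :: "nat \<Rightarrow> nat" where
  "squarefree_count N = card {n \<in> {1..N}. squarefree n}"

text \<open>Uniqueness half of the decomposition: if the square part were \<open>d * k\<close>, then
  \<open>k\<^sup>2\<close> would divide the squarefree \<open>m\<close>, forcing
  \<open>k = 1\<close>.\<close>

lemma square_part_mult_square:
  fixes m d :: nat
  assumes m: "squarefree m" and d: "d > 0"
  shows "square_part (m * d\<^sup>2) = d"
proof -
  let ?x = "square_part (m * d\<^sup>2)"
  have m0: "m > 0"
    using m by (cases m) auto
  have x0: "?x > 0"
    using m0 d by (metis bot_nat_0.not_eq_extremum mult_is_0 power_not_zero square_part_0_iff)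
  have "d dvd ?x"
    by (simp add: dvd_square_part_iff)
  then obtain k where k: "?x = d * k"
    by (elim dvdE)
  have "?x\<^sup>2 dvd m * d\<^sup>2"
    by (rule square_part_square_dvd)
  then have "d\<^sup>2 * k\<^sup>2 dvd d\<^sup>2 * m"
    by (simp only: k power_mult_distrib) (simp only: mult.commute)
  then have "k\<^sup>2 dvd m"
    using d by simp
  then have "k = 1"
    using squarefreeD[OF m] by simp
  then show ?thesis
    by (simp add: k)
qed

text \<open>Every positive integer is uniquely of the form \<open>m * d\<^sup>2\<close> with \<open>m\<close> squarefree.\<close>
lemma sum_squarefree_count:
  assumes r: "N < (Suc r)\<^sup>2"
  shows "(\<Sum>d=1..r. squarefree_count (N div d\<^sup>2)) = N"
proof -
  let ?A = "\<lambda>d. {m \<in> {1..N div d\<^sup>2}. squarefree m}"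
  have "(\<Sum>d=1..r. squarefree_count (N div d\<^sup>2)) = card (SIGMA d:{1..r}. ?A d)"
    by (simp add: squarefree_count_def)
  also have "bij_betw (\<lambda>(d, m). m * d\<^sup>2) (SIGMA d:{1..r}. ?A d) {1..N}"
  proof (rule bij_betw_byWitness[where f' = "\<lambda>n. (square_part n, squarefree_part n)"])
    show "\<forall>a\<in>SIGMA d:{1..r}. ?A d.
        (square_part (case a of (d, m) \<Rightarrow> m * d\<^sup>2), squarefree_part (case a of (d, m) \<Rightarrow> m * d\<^sup>2)) = a"
      by (auto simp: square_part_mult_square squarefree_part_def)
    show "\<forall>n\<in>{1..N}. (case (square_part n, squarefree_part n) of (d, m) \<Rightarrow> m * d\<^sup>2) = n"
      using squarefree_decompose[where 'a = nat] by simp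
    show "(\<lambda>(d, m). m * d\<^sup>2) ` (SIGMA d:{1..r}. ?A d) \<subseteq> {1..N}"
      by (auto simp: less_eq_div_iff_mult_less_eq)
    show "(\<lambda>n. (square_part n, squarefree_part n)) ` {1..N} \<subseteq> (SIGMA d:{1..r}. ?A d)"
    proof clarify
      fix n assume n: "n \<in> {1..N}"
      let ?d = "square_part n" and ?m = "squarefree_part n"
      have eq: "?m * ?d\<^sup>2 = n"
        by (rule squarefree_decompose[symmetric])
      have d0: "?d > 0" and m0: "?m > 0"
        using n by (auto simp: Suc_le_eq intro!: Nat.gr0I)
      have "?d\<^sup>2 \<le> n"
        using m0 by (subst (2) eq[symmetric]) simp
      \<comment> \<open>The hypothesis on \<open>r\<close> is what keeps the square part of every
        \<open>n \<le> N\<close> in the range \<open>1..r\<close>.\<close>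
      then have "?d\<^sup>2 < (Suc r)\<^sup>2"
        using n r by simp
      then have "?d < Suc r"
        by (rule power_less_imp_less_base) simp
      moreover have "?m \<le> N div ?d\<^sup>2"
        using eq n d0 by (simp add: less_eq_div_iff_mult_less_eq)
      ultimately show "?d \<in> {1..r} \<and> ?m \<in> ?A ?d"
        using d0 m0 by (simp add: Suc_le_eq)
    qed
  qed
  then have "card (SIGMA d:{1..r}. ?A d) = card {1..N}"
    by (rule bij_betw_same_card)
  finally show ?thesis
    by simp
qed

section \<open>Partial sums of the inverse squares\<close>

lemma inverse_square_Suc_le:
  assumes "n > 0"
  shows "1 / real (Suc n) ^ 2 \<le> 1 / real n - 1 / real (Suc n)"
proof -
  have "1 / real (Suc n) ^ 2 \<le> 1 / (real n * real (Suc n))"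
    using assms by (intro divide_left_mono) (simp_all add: power2_eq_square)
  also have "\<dots> = 1 / real n - 1 / real (Suc n)"
    using assms by (simp add: divide_simps)
  finally show ?thesis .
qed

text \<open>The value 3/4 is the first term 1/4 plus the telescoping bound 1/2 for the rest. Being
  below 1, it makes the recursion for the counting error contract.\<close>

lemma sum_inverse_squares_from_2_le: "r \<ge> 2 \<Longrightarrow> (\<Sum>d=2..r. 1 / real d ^ 2) \<le> 3 / 4 - 1 / real r"
proof (induction r rule: dec_induct)
  case (step r)
  have "1 / real (Suc r) ^ 2 \<le> 1 / real r - 1 / real (Suc r)"
    using step by (intro inverse_square_Suc_le) simp
  then show ?case
    using step by (simp add: sum.atLeast_Suc_atMost)
qed simp

text \<open>The partial sums increase to the Basel value; adding \<open>1 / n\<close> to them gives,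
  by telescoping, a nonincreasing sequence with the same limit.\<close>

lemma sum_inverse_squares_bounds:
  "pi\<^sup>2 / 6 - 1 / real (Suc r) \<le> (\<Sum>d=1..Suc r. 1 / real d ^ 2)"
  "(\<Sum>d=1..r. 1 / real d ^ 2) \<le> pi\<^sup>2 / 6"
proof -
  let ?s = "\<lambda>n. \<Sum>d=1..n. 1 / real d ^ 2"
  have eq: "(\<Sum>n<m. 1 / real ((n + 1)\<^sup>2)) = ?s m" for m
    by (induction m) simp_all
  have lim: "?s \<longlonglongrightarrow> pi\<^sup>2 / 6"
    using inverse_squares_sums unfolding sums_def eq .
  have antimono: "?s n + 1 / real n \<le> ?s m + 1 / real m" if "0 < m" "m \<le> n" for m n
    using that(2)
  proof (induction n rule: dec_induct)
    case (step n)
    have "1 / real (Suc n) ^ 2 \<le> 1 / real n - 1 / real (Suc n)"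
      using step \<open>0 < m\<close> by (intro inverse_square_Suc_le) simp
    then show ?case
      using step by simp
  qed simp
  have "eventually (\<lambda>n. ?s n + 1 / real n \<le> ?s (Suc r) + 1 / real (Suc r)) sequentially"
    by (rule eventually_sequentiallyI[of "Suc r"], rule antimono) simp_all
  moreover have "(\<lambda>n. ?s n + 1 / real n) \<longlonglongrightarrow> pi\<^sup>2 / 6 + 0"
    by (intro tendsto_add lim lim_1_over_n)
  ultimately have "pi\<^sup>2 / 6 + 0 \<le> ?s (Suc r) + 1 / real (Suc r)"
    by (intro tendsto_upperbound[where F = sequentially]) simp_all
  then show "pi\<^sup>2 / 6 - 1 / real (Suc r) \<le> ?s (Suc r)"
    by linarith
  have "incseq ?s"
    by (rule incseq_SucI) simp
  then show "?s r \<le> pi\<^sup>2 / 6"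
    by (rule incseq_le[OF _ lim])
qed

text \<open>
  Writing \<open>e N = squarefree_count N - (6 / \<pi>\<^sup>2) N\<close>, the identity \<open>sum_squarefree_count\<close> expresses
  \<open>e N\<close> up to \<open>O(\<surd>N)\<close> through \<open>e (N div d\<^sup>2)\<close> for \<open>d \<ge> 2\<close>, and \<open>(\<Sum>d\<ge>2. 1/d\<^sup>2) \<le> 3/4\<close>, so that linear
  bounds on \<open>e\<close> contract.
\<close>
lemma squarefree_count_contraction:
  fixes a C :: real
  defines "e \<equiv> \<lambda>N. real (squarefree_count N) - 6 / pi\<^sup>2 * real N"
  assumes a: "a \<ge> 0" and C: "C \<ge> 0" and bound: "\<And>N. \<bar>e N\<bar> \<le> a * real N + C"
  assumes N: "N > 0"
  shows "\<bar>e N\<bar> \<le> 3 / 4 * a * real N + (C + 4) * sqrt (real N)"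
proof -
  define D :: real where "D = 6 / pi\<^sup>2"
  define r where "r = floor_sqrt N"
  have r1: "r \<ge> 1"
    using N by (simp add: r_def Suc_le_eq)
  have rN: "r\<^sup>2 \<le> N" and Nr: "N < (Suc r)\<^sup>2"
    by (simp_all add: r_def Suc_floor_sqrt_power2_gt)
  have D0: "D > 0"
    by (simp add: D_def)
  \<comment> \<open>The one-term partial sum already gives
    \<open>1 \<le> pi\<^sup>2 / 6\<close>.\<close>
  have D1: "D \<le> 1"
  proof -
    have "6 \<le> pi\<^sup>2"
      using sum_inverse_squares_bounds(2)[of 1] by simp
    then show ?thesis
      by (simp add: D_def)
  qed
  let ?q = "\<lambda>d. real (N div d\<^sup>2)"
  have q: "?q d \<le> real N / real d ^ 2" "real N / real d ^ 2 - 1 \<le> ?q d" for d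
    using of_nat_div_le_of_nat[of N "d\<^sup>2", where 'a = real]
      real_of_int_floor_gt_diff_one[of "real N / real (d\<^sup>2)"]
    unfolding floor_divide_of_nat_eq by simp_all
  have rs: "real r \<le> sqrt (real N)"
    using rN by (intro real_le_rsqrt) (simp flip: of_nat_power)
  have "(\<Sum>d=1..r. e (N div d\<^sup>2)) = real N - D * (\<Sum>d=1..r. ?q d)"
    unfolding e_def D_def[symmetric] sum_subtractf sum_distrib_left[symmetric]
    by (simp only: of_nat_sum[symmetric] sum_squarefree_count[OF Nr])
  \<comment> \<open>The term \<open>d = 1\<close> of the identity is \<open>e N\<close> itself; the
    others have smaller arguments and are controlled by \<open>bound\<close>.\<close>
  also have "(\<Sum>d=1..r. e (N div d\<^sup>2)) = e N + (\<Sum>d=2..r. e (N div d\<^sup>2))"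
    using r1 by (simp add: sum.atLeast_Suc_atMost numeral_2_eq_2)
  finally have e_eq: "e N = (real N - D * (\<Sum>d=1..r. ?q d)) - (\<Sum>d=2..r. e (N div d\<^sup>2))"
    by simp
  \<comment> \<open>Two errors occur: rounding in \<open>N div d\<^sup>2\<close>, at most 1 for each
    \<open>d\<close>, and \<open>N\<close> times the tail of the series, which is at most
    \<open>1 / r\<close>. Both are of order \<open>r\<close>.\<close>
  have "\<bar>real N - D * (\<Sum>d=1..r. ?q d)\<bar> \<le> 4 * real r"
  proof (rule abs_leI)
    let ?S = "\<Sum>d=1..r. 1 / real d ^ 2"
    have "real N * ?S - real r = (\<Sum>d=1..r. real N / real d ^ 2 - 1)"
      by (simp add: sum_subtractf sum_distrib_left)
    also have "\<dots> \<le> (\<Sum>d=1..r. ?q d)"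
      by (intro sum_mono q)
    finally have lo: "real N * ?S - real r \<le> (\<Sum>d=1..r. ?q d)" .
    have "(\<Sum>d=1..r. ?q d) \<le> (\<Sum>d=1..r. real N / real d ^ 2)"
      by (intro sum_mono q)
    also have "\<dots> = real N * ?S"
      by (simp add: sum_distrib_left)
    also have "\<dots> \<le> real N * (pi\<^sup>2 / 6)"
      by (intro mult_left_mono sum_inverse_squares_bounds) simp
    finally have "D * (\<Sum>d=1..r. ?q d) \<le> D * (real N * (pi\<^sup>2 / 6))"
      using D0 by (intro mult_left_mono) simp_all
    also have "\<dots> = real N"
      by (simp add: D_def)
    finally show "- (real N - D * (\<Sum>d=1..r. ?q d)) \<le> 4 * real r"
      by simp
    have "pi\<^sup>2 / 6 - 1 / real r \<le> ?S"
      using sum_inverse_squares_bounds(1)[of "r - 1"] r1 by simp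
    then have "real N * (pi\<^sup>2 / 6 - 1 / real r) \<le> real N * ?S"
      by (intro mult_left_mono) simp_all
    then have "D * (real N * (pi\<^sup>2 / 6 - 1 / real r) - real r) \<le> D * (\<Sum>d=1..r. ?q d)"
      using lo D0 by (intro mult_left_mono) simp_all
    also have "D * (real N * (pi\<^sup>2 / 6 - 1 / real r) - real r)
        = real N - D * (real N / real r + real r)"
      by (simp add: D_def field_simps)
    finally have "real N - D * (real N / real r + real r) \<le> D * (\<Sum>d=1..r. ?q d)" .
    \<comment> \<open>From \<open>N \<le> r\<^sup>2 + 2 * r\<close>; together with the rounding
      error \<open>r\<close> this accounts for the factor 4.\<close>
    moreover have "real N / real r \<le> 3 * real r"
    proof -
      have "N \<le> r * r + 2 * r"
        using Nr by (simp add: power2_eq_square)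
      also have "\<dots> \<le> 3 * (r * r)"
        using r1 by simp
      finally have "real N \<le> real (3 * (r * r))"
        by (simp only: of_nat_le_iff)
      then show ?thesis
        using r1 by (simp add: field_simps)
    qed
    moreover have "D * (real N / real r + real r) \<le> 1 * (real N / real r + real r)"
      using D1 by (intro mult_right_mono) simp_all
    ultimately have "D * (real N / real r + real r) \<le> 4 * real r"
        "real N - D * (\<Sum>d=1..r. ?q d) \<le> D * (real N / real r + real r)"
      by simp_all
    then show "real N - D * (\<Sum>d=1..r. ?q d) \<le> 4 * real r"
      by (rule order_trans[rotated])
  qed
  moreover have "\<bar>\<Sum>d=2..r. e (N div d\<^sup>2)\<bar> \<le> 3 / 4 * a * real N + C * real r"
  proof -
    have "\<bar>\<Sum>d=2..r. e (N div d\<^sup>2)\<bar> \<le> (\<Sum>d=2..r. \<bar>e (N div d\<^sup>2)\<bar>)"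
      by (rule sum_abs)
    also have "\<dots> \<le> (\<Sum>d=2..r. a * (real N / real d ^ 2) + C)"
    proof (rule sum_mono)
      fix d
      have "\<bar>e (N div d\<^sup>2)\<bar> \<le> a * ?q d + C"
        by (rule bound)
      also have "\<dots> \<le> a * (real N / real d ^ 2) + C"
        using a by (intro add_right_mono mult_left_mono q)
      finally show "\<bar>e (N div d\<^sup>2)\<bar> \<le> a * (real N / real d ^ 2) + C" .
    qed
    also have "\<dots> = a * real N * (\<Sum>d=2..r. 1 / real d ^ 2) + C * real (r - 1)"
      by (simp add: sum.distrib sum_distrib_left mult.commute numeral_2_eq_2)
    also have "\<dots> \<le> a * real N * (3 / 4) + C * real r"
    proof (intro add_mono mult_left_mono)
      show "(\<Sum>d=2..r. 1 / real d ^ 2) \<le> 3 / 4"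
      proof (cases "r \<ge> 2")
        case True
        have "0 \<le> 1 / real r"
          by simp
        then show ?thesis
          using sum_inverse_squares_from_2_le[OF True] by linarith
      qed simp
    qed (use a C in simp_all)
    finally show ?thesis
      by simp
  qed
  ultimately have "\<bar>e N\<bar> \<le> 3 / 4 * a * real N + (C + 4) * real r"
    unfolding e_eq by (simp add: algebra_simps)
  also have "\<dots> \<le> 3 / 4 * a * real N + (C + 4) * sqrt (real N)"
    using C rs by (intro add_left_mono mult_left_mono) simp_all
  finally show ?thesis .
qed

text \<open>The contraction is iterated from the trivial bound \<open>2 * N\<close>: each round
  replaces the slope \<open>a\<close> by \<open>4 / 5 * a\<close> at the price of a new constant, so
  \<open>e N\<close> is o(N).\<close>

lemma squarefree_density: "(\<lambda>N. real (squarefree_count N) / real N) \<longlonglongrightarrow> 6 / pi\<^sup>2"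
proof -
  define e where "e = (\<lambda>N. real (squarefree_count N) - 6 / pi\<^sup>2 * real N)"
  have "\<exists>C\<ge>0. \<forall>N. \<bar>e N\<bar> \<le> 2 * (4 / 5) ^ k * real N + C" for k
  proof (induction k)
    case 0
    have "\<bar>e N\<bar> \<le> 2 * real N" for N
    proof -
      have "squarefree_count N \<le> card {1..N}"
        unfolding squarefree_count_def by (intro card_mono) auto
      then have "real (squarefree_count N) \<le> real N"
        by simp
      moreover have "6 / pi\<^sup>2 * real N \<le> 1 * real N"
        using sum_inverse_squares_bounds(2)[of 1] by (intro mult_right_mono) simp_all
      moreover have "0 \<le> 6 / pi\<^sup>2 * real N"
        by simp
      ultimately show ?thesis
        unfolding e_def by linarith
    qed
    then show ?case
      by (intro exI[of _ 0]) simp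
  next
    case (Suc k)
    then obtain C where C: "C \<ge> 0" and bound: "\<And>N. \<bar>e N\<bar> \<le> 2 * (4 / 5) ^ k * real N + C"
      by blast
    define a :: real where "a = 2 * (4 / 5) ^ k"
    have a: "a > 0"
      by (simp add: a_def)
    \<comment> \<open>By completing the square, \<open>B\<close> is the least constant with
      \<open>(C + 4) * sqrt y \<le> a / 20 * y + B\<close> for all real \<open>y \<ge> 0\<close>;
      here 1/20 is the gap between 3/4 and 4/5.\<close>
    define B where "B = (C + 4)\<^sup>2 * 5 / a"
    have "\<bar>e N\<bar> \<le> 4 / 5 * a * real N + B" for N
    proof (cases "N = 0")
      case True
      have "e 0 = 0"
        by (simp add: e_def squarefree_count_def)
      then show ?thesis
        using True a by (simp add: B_def)
    next
      case False
      have "\<bar>e N\<bar> \<le> 3 / 4 * a * real N + (C + 4) * sqrt (real N)"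
        using squarefree_count_contraction[of a C N] bound C a False
        by (simp add: e_def a_def)
      also have "(C + 4) * sqrt (real N) \<le> a / 20 * real N + B"
      proof -
        have "0 \<le> (a / 10 * sqrt (real N) - (C + 4))\<^sup>2"
          by simp
        also have "\<dots> = a / 5 * (a / 20 * real N - (C + 4) * sqrt (real N)) + (C + 4)\<^sup>2"
          by (simp add: power2_diff power_mult_distrib power_divide) (simp add: power2_eq_square algebra_simps)
        finally have "0 \<le> (5 / a) * (a / 5 * (a / 20 * real N - (C + 4) * sqrt (real N)) + (C + 4)\<^sup>2)"
          using a by (intro mult_nonneg_nonneg) simp_all
        also have "\<dots> = a / 20 * real N - (C + 4) * sqrt (real N) + B"
          using a by (simp add: B_def field_simps)
        finally show ?thesis
          by simp
      qed
      finally show ?thesis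
        by simp
    qed
    moreover have "B \<ge> 0"
      using a by (simp add: B_def)
    ultimately show ?case
      by (auto simp: a_def mult_ac)
  qed
  then have bound: "\<exists>C. \<forall>N. \<bar>e N\<bar> \<le> 2 * (4 / 5) ^ k * real N + C" for k
    by blast
  have "(\<lambda>N. e N / real N) \<longlonglongrightarrow> 0"
  proof (rule tendstoI)
    fix \<epsilon> :: real
    assume \<epsilon>: "\<epsilon> > 0"
    \<comment> \<open>The slope \<open>2 * (4 / 5) ^ k\<close> drops below half of \<epsilon>,
      leaving the other half for \<open>C / N\<close>.\<close>
    obtain k where k: "(4 / 5 :: real) ^ k < \<epsilon> / 4"
      using real_arch_pow_inv[of "\<epsilon> / 4" "4 / 5"] \<epsilon> by auto
    obtain C where C: "\<And>N. \<bar>e N\<bar> \<le> 2 * (4 / 5) ^ k * real N + C"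
      using bound by blast
    have "(\<lambda>N. C / real N) \<longlonglongrightarrow> 0"
      by (rule lim_const_over_n)
    then have "eventually (\<lambda>N. C / real N < \<epsilon> / 2) sequentially"
      by (rule order_tendstoD) (use \<epsilon> in simp)
    then show "eventually (\<lambda>N. dist (e N / real N) 0 < \<epsilon>) sequentially"
      using eventually_gt_at_top[of 0]
    proof eventually_elim
      case (elim N)
      have "\<bar>e N\<bar> / real N \<le> 2 * (4 / 5) ^ k + C / real N"
        using C[of N] elim by (simp add: field_simps)
      then have "\<bar>e N\<bar> / real N < \<epsilon>"
        using k elim by linarith
      then show ?case
        by simp
    qed
  qed
  then have "(\<lambda>N. e N / real N + 6 / pi\<^sup>2) \<longlonglongrightarrow> 0 + 6 / pi\<^sup>2"
    by (intro tendsto_intros)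
  moreover have "eventually (\<lambda>N. e N / real N + 6 / pi\<^sup>2 = real (squarefree_count N) / real N) sequentially"
    using eventually_gt_at_top[of 0] by eventually_elim (simp add: e_def field_simps)
  ultimately show ?thesis
    by (simp add: tendsto_cong)
qed

section \<open>Hausdorff dimension and local dimension of a law on sign sequences\<close>

interpretation signs: Metric_space sign_seqs seq_dist
  by (rule Metric_space_sign_seqs)

section \<open>Distances, diameters and cylinders\<close>

lemma seq_dist_le: "(\<And>i. i < n \<Longrightarrow> x i = y i) \<Longrightarrow> seq_dist x y \<le> (1 / 2) ^ n"
proof (cases "x = y")
  case False
  assume eq: "\<And>i. i < n \<Longrightarrow> x i = y i"
  have "x (LEAST k. x k \<noteq> y k) \<noteq> y (LEAST k. x k \<noteq> y k)"
    by (rule LeastI_ex) (use False in \<open>simp add: fun_eq_iff\<close>)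
  then have "n \<le> (LEAST k. x k \<noteq> y k)"
    using eq not_le by blast
  then show ?thesis
    using False by (simp add: seq_dist_def power_decreasing)
qed (simp add: seq_dist_def)

lemma seq_dist_eq:
  assumes "\<And>i. i < n \<Longrightarrow> x i = y i" "x n \<noteq> y n"
  shows "seq_dist x y = (1 / 2) ^ n"
proof -
  have "(LEAST k. x k \<noteq> y k) = n"
    by (rule Least_equality) (use assms not_le in blast)+
  then show ?thesis
    using assms by (auto simp: seq_dist_def)
qed

text \<open>Distances are at most 1, so the supremum defining the diameter is taken over a bounded
  set.\<close>

lemma seq_dist_le_set_diameter:
  assumes "x \<in> S" "y \<in> S"
  shows "seq_dist x y \<le> signs.set_diameter S"
proof -
  have "bdd_above ((\<lambda>(x, y). seq_dist x y) ` (S \<times> S))"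
    using seq_dist_le[of 0] by (intro bdd_aboveI2[of _ _ 1]) auto
  then show ?thesis
    using assms cSUP_upper[of "(x, y)" "S \<times> S" "\<lambda>(x, y). seq_dist x y"]
    by (auto simp: signs.set_diameter_def)
qed

text \<open>For \<open>x\<close> in \<open>sign_seqs\<close> this is the closed ball of radius
  \<open>(1 / 2) ^ n\<close> about \<open>x\<close>.\<close>

definition cylinder :: "nat \<Rightarrow> (nat \<Rightarrow> int) \<Rightarrow> (nat \<Rightarrow> int) set" where
  "cylinder n x = {y \<in> sign_seqs. \<forall>i<n. y i = x i}"

lemma seq_dist_cylinder_le:
  "y \<in> cylinder n x \<Longrightarrow> z \<in> cylinder n x \<Longrightarrow> seq_dist y z \<le> (1 / 2) ^ n"
  by (rule seq_dist_le) (simp add: cylinder_def)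

lemma diameter_power_cylinder_le:
  assumes "s > 0"
  shows "signs.diameter_power s (cylinder n x) \<le> ennreal (2 powr - (s * real n))"
proof (cases "cylinder n x = {}")
  case False
  then obtain y where y: "y \<in> cylinder n x"
    by blast
  have "signs.set_diameter (cylinder n x) \<le> (1 / 2) ^ n"
    using False seq_dist_cylinder_le
    by (auto simp: signs.set_diameter_def intro!: cSUP_least)
  moreover have "0 \<le> signs.set_diameter (cylinder n x)"
    using seq_dist_le_set_diameter[OF y y] by (simp add: seq_dist_def)
  ultimately have "signs.set_diameter (cylinder n x) powr s \<le> ((1 / 2) ^ n) powr s"
    using assms by (intro powr_mono2) simp_all
  also have "(1 / 2 :: real) ^ n = 2 powr - real n"
    by (simp add: powr_minus powr_realpow power_one_over inverse_eq_divide)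
  finally show ?thesis
    using False assms by (simp add: signs.diameter_power_def powr_powr mult.commute ennreal_leI)
qed (simp add: signs.diameter_power_def)

text \<open>Padding with 1 picks one sequence for each prefix of length \<open>n\<close>, so that
  prefixes can be counted as elements of a finite set.\<close>

definition prefix_reps :: "nat \<Rightarrow> (nat \<Rightarrow> int) set" where
  "prefix_reps n = {x \<in> sign_seqs. \<forall>i\<ge>n. x i = 1}"

lemma finite_prefix_reps: "finite (prefix_reps n)"
proof (rule finite_subset)
  show "prefix_reps n \<subseteq> (\<lambda>S i. if i \<in> S then - 1 else 1) ` Pow {..<n}"
  proof
    fix x assume x: "x \<in> prefix_reps n"
    have "x i = (if i \<in> {i. x i = - 1} then - 1 else 1)" for i
      using x by (auto simp: prefix_reps_def sign_seqs_def Pi_iff)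
    moreover have "{i. x i = - 1} \<subseteq> {..<n}"
      using x by (force simp: prefix_reps_def not_less[symmetric])
    ultimately show "x \<in> (\<lambda>S i. if i \<in> S then - 1 else 1) ` Pow {..<n}"
      by (intro image_eqI[of _ _ "{i. x i = - 1}"]) auto
  qed
qed simp

lemma prefix_rep_exists:
  assumes "x \<in> sign_seqs"
  obtains y where "y \<in> prefix_reps n" "\<And>i. i < n \<Longrightarrow> y i = x i"
  by (rule that[of "\<lambda>i. if i < n then x i else 1"])
    (use assms in \<open>auto simp: prefix_reps_def sign_seqs_def Pi_iff\<close>)

section \<open>Covering arguments for a random sign sequence\<close>

locale random_sign_seq = prob_space M for M :: "'w measure" +
  fixes \<phi> :: "'w \<Rightarrow> nat \<Rightarrow> int"
  assumes measurable_prefix: "{\<omega> \<in> space M. \<forall>i<n. \<phi> \<omega> i = x i} \<in> sets M"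
begin

definition prefix_prob :: "(nat \<Rightarrow> int) \<Rightarrow> nat \<Rightarrow> real" where
  "prefix_prob x n = prob {\<omega> \<in> space M. \<forall>i<n. \<phi> \<omega> i = x i}"

lemma prefix_prob_cong:
  assumes "\<And>i. i < n \<Longrightarrow> x i = y i"
  shows "prefix_prob x n = prefix_prob y n"
proof -
  have "(\<forall>i<n. \<phi> \<omega> i = x i) \<longleftrightarrow> (\<forall>i<n. \<phi> \<omega> i = y i)" for \<omega>
    using assms by simp
  then show ?thesis
    by (simp add: prefix_prob_def)
qed

text \<open>Distinct elements of \<open>prefix_reps n\<close> differ below \<open>n\<close>, since
  both are 1 from there on; their prefix events are therefore disjoint.\<close>

lemma sum_prefix_prob_le_1:
  assumes "T \<subseteq> prefix_reps n"
  shows "(\<Sum>x\<in>T. prefix_prob x n) \<le> 1"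
proof -
  let ?C = "\<lambda>x. {\<omega> \<in> space M. \<forall>i<n. \<phi> \<omega> i = x i}"
  have fin: "finite T"
    using assms finite_prefix_reps finite_subset by blast
  have "disjoint_family_on ?C T"
    unfolding disjoint_family_on_def
  proof (intro ballI impI)
    fix x y assume xy: "x \<in> T" "y \<in> T" "x \<noteq> y"
    then obtain i where i: "x i \<noteq> y i"
      by blast
    moreover have "x \<in> prefix_reps n" "y \<in> prefix_reps n"
      using xy assms by auto
    then have "x i = y i" if "i \<ge> n"
      using that by (simp add: prefix_reps_def)
    ultimately have "i < n"
      using not_le by blast
    then show "?C x \<inter> ?C y = {}"
      using i by auto
  qed
  then have "(\<Sum>x\<in>T. prefix_prob x n) = prob (\<Union>x\<in>T. ?C x)"
    unfolding prefix_prob_def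
    by (intro finite_measure_finite_Union[symmetric] fin image_subsetI measurable_prefix)
  also have "\<dots> \<le> 1"
    by (rule prob_le_1)
  finally show ?thesis .
qed

text \<open>Upper bound for the dimension. At most \<open>2 powr (t * n)\<close> prefixes of length
  \<open>n\<close> have mass at least \<open>2 powr - (t * n)\<close>. The cylinders over these
  heavy prefixes, of all lengths from \<open>K\<close> on, cover \<open>A\<close>, and their costs
  for the exponent \<open>s\<close> are bounded by a geometric tail.\<close>

lemma hausdorff_measure_eq_0:
  assumes A: "A \<subseteq> sign_seqs" and t: "0 \<le> t" "t < s"
    and lower: "\<And>x. x \<in> A \<Longrightarrow> eventually (\<lambda>n. 2 powr - (t * real n) \<le> prefix_prob x n) sequentially"
  shows "signs.hausdorff_measure s A = 0"
proof -
  have "signs.hausdorff_premeasure s \<delta> A \<le> 0 + ennreal \<epsilon>" if "\<delta> > 0" "\<epsilon> > 0" for \<delta> \<epsilon> :: real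
  proof -
    define q :: real where "q = 2 powr (t - s)"
    have q: "0 < q" "q < 1"
      using t powr_less_mono[of "t - s" 0 2] by (simp_all add: q_def)
    have "(\<lambda>K. (1 / 2 :: real) ^ K) \<longlonglongrightarrow> 0"
      by (rule LIMSEQ_power_zero) simp
    then have 1: "eventually (\<lambda>K. (1 / 2 :: real) ^ K < \<delta>) sequentially"
      by (rule order_tendstoD) fact
    have "(\<lambda>K. q ^ K / (1 - q)) \<longlonglongrightarrow> 0 / (1 - q)"
      using q by (intro tendsto_divide LIMSEQ_power_zero tendsto_const) simp_all
    then have 2: "eventually (\<lambda>K. q ^ K / (1 - q) < \<epsilon>) sequentially"
      by (rule order_tendstoD) (use \<open>\<epsilon> > 0\<close> in simp)
    \<comment> \<open>\<open>K\<close> is chosen so that the cylinders are finer than \<delta> and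
      the geometric tail is below \<epsilon>.\<close>
    from eventually_happens[OF eventually_conj[OF 1 2]]
    obtain K where K: "(1 / 2 :: real) ^ K < \<delta>" "q ^ K / (1 - q) < \<epsilon>"
      by auto
    define T where "T = (\<lambda>n. {x \<in> prefix_reps n. 2 powr - (t * real n) \<le> prefix_prob x n})"
    have finT: "finite (T n)" for n
      unfolding T_def using finite_prefix_reps by simp
    have cardT: "real (card (T n)) \<le> 2 powr (t * real n)" for n
    proof -
      have "real (card (T n)) * 2 powr - (t * real n) \<le> (\<Sum>x\<in>T n. prefix_prob x n)"
        by (intro sum_bounded_below) (simp add: T_def)
      also have "\<dots> \<le> 1"
        by (intro sum_prefix_prob_le_1) (auto simp: T_def)
      finally show ?thesis
        by (simp add: powr_minus field_simps)
    qed
    have "\<forall>n. \<exists>h. bij_betw h {0..<card (T n)} (T n)"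
      using finT ex_bij_betw_nat_finite by blast
    then obtain h where h: "\<And>n. bij_betw (h n) {0..<card (T n)} (T n)"
      by metis
    \<comment> \<open>Row \<open>m\<close> lists the heavy prefixes of length \<open>m + K\<close>;
      the slots past the last one hold the empty set, which costs nothing.
      \<open>prod_decode\<close> then turns the rows into a single sequence.\<close>
    define V where "V = (\<lambda>(m, k). if k < card (T (m + K)) then cylinder (m + K) (h (m + K) k) else {})"
    define U where "U = (\<lambda>i. V (prod_decode i))"
    have cover: "A \<subseteq> (\<Union>i. U i)"
    proof
      fix x assume x: "x \<in> A"
      obtain N where "\<And>n. n \<ge> N \<Longrightarrow> 2 powr - (t * real n) \<le> prefix_prob x n"
        using lower[OF x] unfolding eventually_sequentially by blast
      then obtain n where n: "n \<ge> K" "2 powr - (t * real n) \<le> prefix_prob x n"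
        using max.cobounded1 max.cobounded2 by blast
      obtain y where y: "y \<in> prefix_reps n" "\<And>i. i < n \<Longrightarrow> y i = x i"
        using x A prefix_rep_exists by blast
      have "y \<in> T n"
        using n y prefix_prob_cong[of n y x] by (simp add: T_def)
      then obtain k where k: "k < card (T n)" "y = h n k"
        using bij_betw_imp_surj_on[OF h[of n]] by (metis atLeastLessThan_iff imageE)
      have "x \<in> V (n - K, k)"
        using k n x y A by (auto simp: V_def cylinder_def)
      then have "x \<in> U (prod_encode (n - K, k))"
        by (simp add: U_def)
      then show "x \<in> (\<Union>i. U i)"
        by blast
    qed
    have small: "U i \<subseteq> sign_seqs \<and> (\<forall>x\<in>U i. \<forall>y\<in>U i. seq_dist x y \<le> \<delta>)" for i
    proof -
      obtain m k where mk: "prod_decode i = (m, k)"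
        by force
      have "(1 / 2 :: real) ^ (m + K) \<le> (1 / 2) ^ K"
        by (rule power_decreasing) simp_all
      then have "(1 / 2 :: real) ^ (m + K) \<le> \<delta>"
        using K by linarith
      then show ?thesis
        using seq_dist_cylinder_le[of _ "m + K" "h (m + K) k"]
        by (auto simp: U_def V_def mk cylinder_def intro: order_trans)
    qed
    have "signs.hausdorff_premeasure s \<delta> A \<le> (\<Sum>i. signs.diameter_power s (U i))"
      unfolding signs.hausdorff_premeasure_def by (rule INF_lower) (use cover small in simp)
    also have "\<dots> = (\<Sum>m. \<Sum>k. signs.diameter_power s (V (m, k)))"
      unfolding U_def by (rule suminf_ennreal_2dimen) simp
    also have "\<dots> \<le> (\<Sum>m. ennreal (q ^ (m + K)))"
    proof (intro suminf_le summableI)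
      fix m
      let ?n = "m + K"
      have "(\<Sum>k. signs.diameter_power s (V (m, k))) = (\<Sum>k<card (T ?n). signs.diameter_power s (V (m, k)))"
        by (rule suminf_finite) (auto simp: V_def signs.diameter_power_def)
      also have "\<dots> \<le> of_nat (card {..<card (T ?n)}) * ennreal (2 powr - (s * real ?n))"
        by (rule sum_bounded_above) (use t diameter_power_cylinder_le[of s ?n] in \<open>simp add: V_def\<close>)
      also have "\<dots> = ennreal (real (card (T ?n)) * 2 powr - (s * real ?n))"
        by (simp add: ennreal_mult ennreal_of_nat_eq_real_of_nat)
      also have "\<dots> \<le> ennreal (2 powr (t * real ?n) * 2 powr - (s * real ?n))"
        by (intro ennreal_leI mult_right_mono cardT) simp
      also have "2 powr (t * real ?n) * 2 powr - (s * real ?n) = q powr real ?n"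
        by (simp add: q_def powr_powr powr_add[symmetric] algebra_simps)
      also have "\<dots> = q ^ ?n"
        by (rule powr_realpow) (rule q)
      finally show "(\<Sum>k. signs.diameter_power s (V (m, k))) \<le> ennreal (q ^ ?n)" .
    qed
    also have "\<dots> = ennreal (q ^ K / (1 - q))"
    proof (rule suminf_ennreal_eq)
      have "(\<lambda>m. q ^ K * q ^ m) sums (q ^ K * (1 / (1 - q)))"
        using q by (intro sums_mult geometric_sums) simp
      then show "(\<lambda>m. q ^ (m + K)) sums (q ^ K / (1 - q))"
        by (simp add: power_add mult.commute)
    qed (use q in simp)
    also have "\<dots> \<le> ennreal \<epsilon>"
      using K by (intro ennreal_leI) simp
    finally show ?thesis
      by simp
  qed
  then have "signs.hausdorff_premeasure s \<delta> A \<le> 0" if "\<delta> > 0" for \<delta>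
    by (rule ennreal_le_epsilon) (use that in simp)
  then have "(SUP \<delta>\<in>{0<..}. signs.hausdorff_premeasure s \<delta> A) \<le> 0"
    by (intro SUP_least) simp
  then show ?thesis
    by (simp add: signs.hausdorff_measure_def)
qed

text \<open>Mass distribution principle for one covering set: a set \<open>U\<close> of diameter
  \<open>(1 / 2) ^ n\<close> lies in one cylinder of length \<open>n\<close>, and if
  \<open>U\<close> meets \<open>E\<close>, the mass of that cylinder is at most the diameter to the
  power \<open>s\<close>. The preimage of \<open>U \<inter> E\<close> need not be measurable, hence
  the superset \<open>B\<close>.\<close>

lemma emeasure_cover_le:
  assumes U: "U \<subseteq> sign_seqs" "\<And>x y. x \<in> U \<Longrightarrow> y \<in> U \<Longrightarrow> seq_dist x y \<le> (1 / 2) ^ K"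
    and st: "0 \<le> s" "s < t"
    and E: "\<And>x n. x \<in> E \<Longrightarrow> n \<ge> K \<Longrightarrow> prefix_prob x n \<le> 2 powr - (t * real n)"
  shows "\<exists>B\<in>sets M. {\<omega> \<in> space M. \<phi> \<omega> \<in> U \<inter> E} \<subseteq> B \<and> emeasure M B \<le> signs.diameter_power s U"
proof -
  let ?C = "\<lambda>x n. {\<omega> \<in> space M. \<forall>i<n. \<phi> \<omega> i = x i}"
  \<comment> \<open>A singleton has diameter 0 and determines no cylinder length, so it is split
    off.\<close>
  consider "U \<inter> E = {}" | x where "U = {x}" "x \<in> E" | x y where "x \<in> U" "x \<in> E" "y \<in> U" "x \<noteq> y"
    by blast
  then show ?thesis
  proof cases
    case 1
    then show ?thesis
      by (intro bexI[of _ "{}"]) auto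
  next
    case (2 x)
    \<comment> \<open>For \<open>s > 0\<close> a singleton costs 0, so the event that \<phi> equals
      \<open>x\<close> must be null; it is, because \<open>t > 0\<close> makes the prefix masses
      tend to 0.\<close>
    define B where "B = (\<Inter>n. ?C x n)"
    have B: "B \<in> sets M"
      unfolding B_def by (intro sets.countable_INT image_subsetI measurable_prefix) simp
    have le: "measure M B \<le> 2 powr - (t * real n)" if "n \<ge> K" for n
    proof -
      have "measure M B \<le> prefix_prob x n"
        unfolding prefix_prob_def B_def by (rule finite_measure_mono[OF _ measurable_prefix]) auto
      then show ?thesis
        using E[OF 2(2) that] by simp
    qed
    have lim: "(\<lambda>n. (2 powr - t) ^ n) \<longlonglongrightarrow> 0"
      using st powr_less_mono[of "- t" 0 2] by (intro LIMSEQ_power_zero) simp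
    have "measure M B \<le> 0"
      by (rule tendsto_lowerbound[OF lim])
        (auto simp: eventually_sequentially powr_realpow[symmetric] powr_powr intro!: exI[of _ K] le)
    then have "emeasure M B = 0"
      by (simp add: emeasure_eq_measure measure_le_0_iff)
    moreover have "{\<omega> \<in> space M. \<phi> \<omega> \<in> U \<inter> E} \<subseteq> B"
      using 2 by (auto simp: B_def)
    ultimately show ?thesis
      using B by (intro bexI[of _ B]) simp_all
  next
    case (3 x y)
    \<comment> \<open>The least \<open>n\<close> with \<open>P n\<close> is the first index at which
      two points of \<open>U\<close> differ: all of \<open>U\<close> agrees below it, and two points
      realise the distance \<open>(1 / 2) ^ n\<close>.\<close>
    define P where "P = (\<lambda>n. \<exists>y\<in>U. \<exists>z\<in>U. y n \<noteq> z n)"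
    define n where "n = Least P"
    have "\<exists>n. P n"
      using 3 by (auto simp: P_def fun_eq_iff)
    then have "P n"
      unfolding n_def by (rule LeastI_ex)
    then obtain u v where uv: "u \<in> U" "v \<in> U" "u n \<noteq> v n"
      by (auto simp: P_def)
    have agree: "y i = z i" if "i < n" "y \<in> U" "z \<in> U" for i y z
      using that not_less_Least[of i P] by (auto simp: n_def P_def)
    have duv: "seq_dist u v = (1 / 2) ^ n"
      using uv agree by (intro seq_dist_eq) auto
    then have "(1 / 2 :: real) ^ n \<le> (1 / 2) ^ K"
      using U(2)[OF uv(1,2)] by simp
    then have "K \<le> n"
      by (subst (asm) power_decreasing_iff) auto
    have "(1 / 2) ^ n \<le> signs.set_diameter U"
      using seq_dist_le_set_diameter[OF uv(1,2)] duv by simp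
    have "prefix_prob x n \<le> 2 powr - (t * real n)"
      by (rule E) fact+
    also have "\<dots> \<le> 2 powr - (s * real n)"
      using st by (intro powr_mono) (auto intro: mult_right_mono)
    also have "\<dots> = ((1 / 2) ^ n) powr s"
      by (simp add: powr_powr powr_minus powr_realpow[symmetric] powr_divide mult.commute inverse_eq_divide)
    also have "\<dots> \<le> signs.set_diameter U powr s"
      by (intro powr_mono2 st) (simp, fact)
    finally have le: "prefix_prob x n \<le> signs.set_diameter U powr s" .
    have "ennreal (prefix_prob x n) \<le> signs.diameter_power s U"
    proof (cases "s = 0")
      case True
      have "ennreal (prefix_prob x n) \<le> 1"
        unfolding prefix_prob_def by simp
      then show ?thesis
        using True 3 by (auto simp: signs.diameter_power_def)
    next
      case False
      then show ?thesis
        using le 3 by (auto simp: signs.diameter_power_def intro: ennreal_leI)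
    qed
    then have "emeasure M (?C x n) \<le> signs.diameter_power s U"
      by (simp add: prefix_prob_def emeasure_eq_measure)
    moreover have "{\<omega> \<in> space M. \<phi> \<omega> \<in> U \<inter> E} \<subseteq> ?C x n"
      using agree 3 by blast
    ultimately show ?thesis
      using measurable_prefix by blast
  qed
qed

text \<open>Lower bound for the dimension. By \<open>upper\<close>, \<open>A\<close> is the union of
  the sets \<open>E K\<close> on which the mass bound holds from \<open>K\<close> on. Vanishing
  Hausdorff measure would give covers of every \<open>E K\<close> of arbitrarily small cost, so
  \<phi> would almost surely avoid all of them, hence \<open>A\<close>.\<close>

lemma hausdorff_measure_neq_0:
  assumes A: "AE \<omega> in M. \<phi> \<omega> \<in> A" and st: "0 \<le> s" "s < t"
    and upper: "\<And>x. x \<in> A \<Longrightarrow> eventually (\<lambda>n. prefix_prob x n \<le> 2 powr - (t * real n)) sequentially"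
  shows "signs.hausdorff_measure s A \<noteq> 0"
proof
  assume 0: "signs.hausdorff_measure s A = 0"
  define E where "E = (\<lambda>K. {x \<in> A. \<forall>n\<ge>K. prefix_prob x n \<le> 2 powr - (t * real n)})"
  have "AE \<omega> in M. \<phi> \<omega> \<notin> E K" for K
  proof -
    have "\<exists>B\<in>sets M. {\<omega> \<in> space M. \<phi> \<omega> \<in> E K} \<subseteq> B \<and> emeasure M B \<le> ennreal (inverse (real (Suc j)))" for j
    proof -
      \<comment> \<open>The scale \<open>(1 / 2) ^ K\<close> forces the cylinder lengths in
        \<open>emeasure_cover_le\<close> to be at least \<open>K\<close>, where the bound in
        \<open>E K\<close> applies.\<close>
      have "signs.hausdorff_premeasure s ((1 / 2) ^ K) A \<le> signs.hausdorff_measure s A"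
        unfolding signs.hausdorff_measure_def by (rule SUP_upper) simp
      also have "\<dots> < ennreal (inverse (real (Suc j)))"
        using 0 by simp
      finally obtain U where U: "A \<subseteq> (\<Union>i. U i)"
          "\<And>i. U i \<subseteq> sign_seqs" "\<And>i x y. x \<in> U i \<Longrightarrow> y \<in> U i \<Longrightarrow> seq_dist x y \<le> (1 / 2) ^ K"
          "(\<Sum>i. signs.diameter_power s (U i)) < ennreal (inverse (real (Suc j)))"
        unfolding signs.hausdorff_premeasure_def INF_less_iff by auto
      have "\<forall>i. \<exists>B\<in>sets M. {\<omega> \<in> space M. \<phi> \<omega> \<in> U i \<inter> E K} \<subseteq> B \<and>
          emeasure M B \<le> signs.diameter_power s (U i)"
        by (intro allI emeasure_cover_le[of _ K s t] U st) (auto simp: E_def)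
      then obtain B where B: "\<And>i. B i \<in> sets M" "\<And>i. {\<omega> \<in> space M. \<phi> \<omega> \<in> U i \<inter> E K} \<subseteq> B i"
          "\<And>i. emeasure M (B i) \<le> signs.diameter_power s (U i)"
        by metis
      have "{\<omega> \<in> space M. \<phi> \<omega> \<in> E K} \<subseteq> (\<Union>i. B i)"
        using B(2) U(1) by (fastforce simp: E_def)
      moreover have "emeasure M (\<Union>i. B i) \<le> (\<Sum>i. emeasure M (B i))"
        using B by (intro emeasure_subadditive_countably) auto
      moreover have "\<dots> \<le> (\<Sum>i. signs.diameter_power s (U i))"
        by (intro suminf_le summableI B)
      ultimately show ?thesis
        using B(1) U(4) by (intro bexI[of _ "\<Union>i. B i"]) auto
    qed
    then obtain B where B: "\<And>j. B j \<in> sets M" "\<And>j. {\<omega> \<in> space M. \<phi> \<omega> \<in> E K} \<subseteq> B j"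
        "\<And>j. emeasure M (B j) \<le> ennreal (inverse (real (Suc j)))"
      by metis
    have "(\<Inter>j. B j) \<in> null_sets M"
    proof (rule null_setsI)
      have le: "measure M (\<Inter>j. B j) \<le> inverse (real (Suc j))" for j
      proof -
        have "emeasure M (\<Inter>j. B j) \<le> emeasure M (B j)"
          using B by (intro emeasure_mono) auto
        also note B(3)
        finally show ?thesis
          by (simp add: emeasure_eq_measure)
      qed
      have "measure M (\<Inter>j. B j) \<le> 0"
        by (rule tendsto_lowerbound[OF LIMSEQ_inverse_real_of_nat]) (use le in auto)
      then show "emeasure M (\<Inter>j. B j) = 0"
        by (simp add: emeasure_eq_measure measure_le_0_iff)
    qed (use B in auto)
    then show ?thesis
      by (rule AE_I') (use B in auto)
  qed
  then have "AE \<omega> in M. \<forall>K. \<phi> \<omega> \<notin> E K"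
    by (subst AE_all_countable) simp
  with A have "AE \<omega> in M. False"
  proof eventually_elim
    case (elim \<omega>)
    then show ?case
      using upper[of "\<phi> \<omega>"] by (auto simp: E_def eventually_sequentially)
  qed
  then show False
    by simp
qed

text \<open>A special case of Billingsley's theorem.\<close>
theorem hausdorff_dim_eq_local_dim:
  assumes A: "A \<subseteq> sign_seqs" "AE \<omega> in M. \<phi> \<omega> \<in> A" and c: "0 \<le> c"
    and pos: "\<And>x n. x \<in> A \<Longrightarrow> prefix_prob x n > 0"
    and lim: "\<And>x. x \<in> A \<Longrightarrow> (\<lambda>n. ln (prefix_prob x n) / real n) \<longlonglongrightarrow> - (c * ln 2)"
  shows "signs.hausdorff_dim A = ereal c"
proof (rule antisym)
  have powr_iff: "- a * ln 2 \<le> ln (prefix_prob x n) / real n \<longleftrightarrow> 2 powr - (a * real n) \<le> prefix_prob x n"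
      "ln (prefix_prob x n) / real n \<le> - a * ln 2 \<longleftrightarrow> prefix_prob x n \<le> 2 powr - (a * real n)"
    if "x \<in> A" "n > 0" for x n a
  proof -
    have "2 powr - (a * real n) \<le> prefix_prob x n \<longleftrightarrow> - (a * real n * ln 2) \<le> ln (prefix_prob x n)"
      using pos[OF that(1)] ln_le_cancel_iff[of "2 powr - (a * real n)" "prefix_prob x n"]
      by (simp add: ln_powr)
    moreover have "prefix_prob x n \<le> 2 powr - (a * real n) \<longleftrightarrow> ln (prefix_prob x n) \<le> - (a * real n * ln 2)"
      using pos[OF that(1)] ln_le_cancel_iff[of "prefix_prob x n" "2 powr - (a * real n)"]
      by (simp add: ln_powr)
    ultimately show "- a * ln 2 \<le> ln (prefix_prob x n) / real n \<longleftrightarrow> 2 powr - (a * real n) \<le> prefix_prob x n"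
      "ln (prefix_prob x n) / real n \<le> - a * ln 2 \<longleftrightarrow> prefix_prob x n \<le> 2 powr - (a * real n)"
      using that(2) by (simp_all add: pos_le_divide_eq pos_divide_le_eq mult_ac)
  qed
  show "signs.hausdorff_dim A \<le> ereal c"
  proof (rule ereal_le_epsilon2)
    fix \<epsilon> :: real assume \<epsilon>: "\<epsilon> > 0"
    have "signs.hausdorff_measure (c + \<epsilon>) A = 0"
    \<comment> \<open>The exponent \<open>c + \<epsilon> / 2\<close> lies strictly above the local
      dimension, for the mass estimate, and strictly below \<open>c + \<epsilon>\<close>, for
      convergence.\<close>
    proof (rule hausdorff_measure_eq_0[of _ "c + \<epsilon> / 2"])
      fix x assume x: "x \<in> A"
      have "- (c + \<epsilon> / 2) * ln 2 < - (c * ln 2)"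
        using \<epsilon> by (simp add: algebra_simps)
      then have "eventually (\<lambda>n. - (c + \<epsilon> / 2) * ln 2 < ln (prefix_prob x n) / real n) sequentially"
        using lim[OF x] by (rule order_tendstoD(1)[rotated])
      then show "eventually (\<lambda>n. 2 powr - ((c + \<epsilon> / 2) * real n) \<le> prefix_prob x n) sequentially"
        using eventually_gt_at_top[of 0]
        by eventually_elim (rule powr_iff(1)[OF x, THEN iffD1, OF _ less_imp_le])
    qed (use A c \<epsilon> in auto)
    then show "signs.hausdorff_dim A \<le> ereal c + ereal \<epsilon>"
      unfolding signs.hausdorff_dim_def using c \<epsilon> by (auto intro!: INF_lower2[of "c + \<epsilon>"])
  qed
  show "ereal c \<le> signs.hausdorff_dim A"
    unfolding signs.hausdorff_dim_def
  proof (rule INF_greatest, rule ccontr)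
    fix s assume s: "s \<in> {s. 0 \<le> s \<and> signs.hausdorff_measure s A = 0}" and "\<not> ereal c \<le> ereal s"
    then have "s < c"
      by simp
    \<comment> \<open>The midpoint likewise separates \<open>s\<close> from
      \<open>c\<close>.\<close>
    define t where "t = (s + c) / 2"
    have "signs.hausdorff_measure s A \<noteq> 0"
    proof (rule hausdorff_measure_neq_0[of _ _ t])
      fix x assume x: "x \<in> A"
      have "- (c * ln 2) < - t * ln 2"
        using \<open>s < c\<close> by (simp add: t_def)
      then have "eventually (\<lambda>n. ln (prefix_prob x n) / real n < - t * ln 2) sequentially"
        using lim[OF x] by (rule order_tendstoD(2)[rotated])
      then show "eventually (\<lambda>n. prefix_prob x n \<le> 2 powr - (t * real n)) sequentially"
        using eventually_gt_at_top[of 0]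
        by eventually_elim (rule powr_iff(2)[OF x, THEN iffD1, OF _ less_imp_le])
    qed (use A s \<open>s < c\<close> in \<open>auto simp: t_def\<close>)
    then show False
      using s by simp
  qed
qed

end

section \<open>Biased coins along the squarefree numbers\<close>

definition sign_of :: "bool \<Rightarrow> int" where
  "sign_of b = (if b then 1 else - 1)"

text \<open>
  \<open>decode w\<close> is the sequence \<open>x\<close> for which \<open>x\<^sub>0\<close> and, for \<open>n \<ge> 0\<close>, the products \<open>\<mu>(n) x\<^sub>n x\<^sub>n\<^sub>+\<^sub>1\<close>
  (or just \<open>x\<^sub>n\<^sub>+\<^sub>1\<close> if \<open>\<mu>(n) = 0\<close>) are the signs listed by \<open>w\<close>.
\<close>
primrec decode :: "(nat \<Rightarrow> bool) \<Rightarrow> nat \<Rightarrow> int" where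
  "decode w 0 = sign_of (w 0)"
| "decode w (Suc n) = sign_of (w (Suc n)) * (if squarefree n then moebius_mu n * decode w n else 1)"

text \<open>Inverse of \<open>decode\<close> on \<open>sign_seqs\<close>: a factor 1 or -1 is undone
  by multiplying by it once more.\<close>

primrec encode :: "(nat \<Rightarrow> int) \<Rightarrow> nat \<Rightarrow> bool" where
  "encode x 0 \<longleftrightarrow> x 0 = 1"
| "encode x (Suc n) \<longleftrightarrow> x (Suc n) * (if squarefree n then moebius_mu n * x n else 1) = 1"

lemma moebius_mu_squarefree: "squarefree n \<Longrightarrow> moebius_mu n = 1 \<or> moebius_mu n = - 1"
  by (cases "even (card (prime_factors n))") (simp_all add: moebius_mu_def)

lemma moebius_mu_not_squarefree: "\<not> squarefree n \<Longrightarrow> moebius_mu n = 0"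
  by (simp add: moebius_mu_def)

lemma decode_cases: "decode w n = 1 \<or> decode w n = - 1"
proof (induction n)
  case (Suc n)
  then show ?case
    using moebius_mu_squarefree[of n] by (auto simp: sign_of_def)
qed (simp add: sign_of_def)

lemma decode_in_sign_seqs: "decode w \<in> sign_seqs"
  using decode_cases[of w] by (auto simp: sign_seqs_def)

lemma sign_seqs_cases: "x \<in> sign_seqs \<Longrightarrow> x n = 1 \<or> x n = - 1"
  by (auto simp: sign_seqs_def Pi_iff)

text \<open>At squarefree \<open>n\<close> the squares of \<open>moebius_mu n\<close> and
  \<open>decode w n\<close> are 1, which leaves only the coin.\<close>

lemma moebius_mu_mult_decode:
  "moebius_mu n * decode w n * decode w (Suc n) = (if squarefree n then sign_of (w (Suc n)) else 0)"
  using moebius_mu_squarefree[of n] decode_cases[of w n]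
  by (auto simp: moebius_mu_not_squarefree)

text \<open>Once the earlier values agree, \<open>decode w n\<close> is the coin \<open>w n\<close>
  times a known sign. Cylinders of sequences thus become cylinders of independent coins.\<close>

lemma decode_prefix_iff:
  assumes "x \<in> sign_seqs"
  shows "(\<forall>i<n. decode w i = x i) \<longleftrightarrow> (\<forall>i<n. w i = encode x i)"
proof (induction n)
  case (Suc n)
  have "decode w n = x n \<longleftrightarrow> w n = encode x n" if "\<forall>i<n. decode w i = x i"
  proof (cases n)
    case 0
    then show ?thesis
      using sign_seqs_cases[OF assms, of 0] by (auto simp: sign_of_def)
  next
    case (Suc m)
    define c where "c = (if squarefree m then moebius_mu m * x m else 1)"
    have "c = 1 \<or> c = - 1"
      using sign_seqs_cases[OF assms, of m] moebius_mu_squarefree[of m] by (auto simp: c_def)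
    moreover have "decode w m = x m"
      using that Suc by simp
    then have "decode w n = sign_of (w n) * c" "encode x n \<longleftrightarrow> x n * c = 1"
      by (simp_all add: Suc c_def)
    ultimately show ?thesis
      using sign_seqs_cases[OF assms, of n] by (elim disjE) (simp_all add: sign_of_def)
  qed
  then show ?case
    unfolding All_less_Suc using Suc.IH by blast
qed simp

section \<open>The coin law and its prefix probabilities\<close>

text \<open>Coin \<open>i\<close> decides the term of index \<open>i - 1\<close>, hence the shift.
  As 0 is not squarefree, coins 0 and 1 are both fair.\<close>

definition bias :: "real \<Rightarrow> nat \<Rightarrow> real" where
  "bias p i = (if i > 0 \<and> squarefree (i - 1) then p else 1 / 2)"

definition coin_measure :: "real \<Rightarrow> (nat \<Rightarrow> bool) measure" where
  "coin_measure p = (\<Pi>\<^sub>M i\<in>UNIV. measure_pmf (bernoulli_pmf (bias p i)))"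

lemma squarefree_count_Suc:
  "squarefree_count (Suc N) = squarefree_count N + (if squarefree (Suc N) then 1 else 0)"
proof -
  have "{n \<in> {1..Suc N}. squarefree n} =
      (if squarefree (Suc N) then insert (Suc N) {n \<in> {1..N}. squarefree n} else {n \<in> {1..N}. squarefree n})"
    by (auto simp: le_Suc_eq)
  then show ?thesis
    by (simp add: squarefree_count_def)
qed

lemma real_squarefree_count: "real (squarefree_count N) = (\<Sum>n=1..N. if squarefree n then 1 else 0)"
  by (induction N) (simp_all add: squarefree_count_Suc, simp add: squarefree_count_def)

context
  fixes p :: real
  assumes p: "0 < p" "p < 1"
begin

lemma bias_bounds: "0 < bias p i" "bias p i < 1"
  using p by (simp_all add: bias_def)

interpretation coins: product_prob_space "\<lambda>i. measure_pmf (bernoulli_pmf (bias p i))" UNIV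
  by unfold_locales

lemma emeasure_coin_prefix:
  "emeasure (coin_measure p) {w \<in> space (coin_measure p). \<forall>i<n. w i = b i} =
     ennreal (\<Prod>i<n. pmf (bernoulli_pmf (bias p i)) (b i))"
  using coins.emeasure_PiM_Collect[of "{..<n}" "\<lambda>i. {b i}"]
  by (simp add: coin_measure_def emeasure_pmf_single prod_ennreal Ball_def)

lemma measurable_coin_prefix:
  "{w \<in> space (coin_measure p). \<forall>i<n. w i = b i} \<in> sets (coin_measure p)"
proof -
  have "{w \<in> space (coin_measure p). \<forall>i\<in>{..<n}. w i = b i} \<in> sets (coin_measure p)"
    unfolding coin_measure_def
    by (intro sets.sets_Collect_finite_All sets_Collect_single') simp_all
  then show ?thesis
    by (simp only: Ball_def lessThan_iff)
qed

lemma measurable_decode_prefix: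
  "{w \<in> space (coin_measure p). \<forall>i<n. decode w i = x i} \<in> sets (coin_measure p)"
proof (cases "\<forall>i<n. x i = 1 \<or> x i = - 1")
  case True
  \<comment> \<open>Padding past \<open>n\<close> leaves the event unchanged and gives the full sign
    sequence that \<open>decode_prefix_iff\<close> asks for. A prefix with any other value has an
    empty event.\<close>
  define y where "y = (\<lambda>i. if i < n then x i else 1)"
  have "y i = 1 \<or> y i = - 1" for i
    using True by (simp add: y_def)
  then have y: "y \<in> sign_seqs"
    by (auto simp: sign_seqs_def)
  have "(\<forall>i<n. decode w i = x i) \<longleftrightarrow> (\<forall>i<n. w i = encode y i)" for w
    unfolding decode_prefix_iff[OF y, symmetric] by (simp add: y_def)
  then show ?thesis
    using measurable_coin_prefix[of n "encode y"] by (simp only:)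
next
  case False
  then obtain i where i: "i < n" "x i \<noteq> 1" "x i \<noteq> - 1"
    by blast
  have "decode w i \<noteq> x i" for w
    using decode_cases[of w i] i by auto
  then have "{w \<in> space (coin_measure p). \<forall>i<n. decode w i = x i} = {}"
    using i by blast
  then show ?thesis
    by (simp only: sets.empty_sets)
qed

lemma random_sign_seq_decode: "random_sign_seq (coin_measure p) decode"
proof -
  interpret prob_space "coin_measure p"
    unfolding coin_measure_def by unfold_locales
  show ?thesis
    by unfold_locales (rule measurable_decode_prefix)
qed

interpretation seqs: random_sign_seq "coin_measure p" decode
  by (rule random_sign_seq_decode)

lemma prefix_prob_eq:
  assumes "x \<in> sign_seqs"
  shows "seqs.prefix_prob x n = (\<Prod>i<n. pmf (bernoulli_pmf (bias p i)) (encode x i))"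
  unfolding seqs.prefix_prob_def decode_prefix_iff[OF assms]
  by (simp add: measure_def emeasure_coin_prefix prod_nonneg)

lemma pmf_bias_pos: "pmf (bernoulli_pmf (bias p i)) b > 0"
  using bias_bounds[of i] by (cases b) simp_all

lemma prefix_prob_pos: "x \<in> sign_seqs \<Longrightarrow> seqs.prefix_prob x n > 0"
  by (simp add: prefix_prob_eq prod_pos pmf_bias_pos)

text \<open>
  Since \<open>\<mu>(n) x\<^sub>n x\<^sub>n\<^sub>+\<^sub>1\<close> takes only the values \<open>1\<close> and \<open>- 1\<close> at squarefree \<open>n\<close>, the logarithm of the
  conditional probability of \<open>x\<^sub>n\<^sub>+\<^sub>1\<close> is an affine function of it.
\<close>
lemma ln_prefix_prob:
  assumes x: "x \<in> sign_seqs"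
  shows "ln (seqs.prefix_prob x (N + 2)) =
    - ln 2 * real (N + 2) + (ln 2 + (ln p + ln (1 - p)) / 2) * real (squarefree_count N)
    + (ln p - ln (1 - p)) / 2 * real_of_int (\<Sum>n=1..N. moebius_mu n * x n * x (n + 1))"
proof (induction N)
  case 0
  \<comment> \<open>A prefix of length \<open>N + 2\<close> uses coins 0 to \<open>N + 1\<close>,
    coin \<open>n + 1\<close> belonging to index \<open>n\<close>; for \<open>N = 0\<close> only the
    two fair coins remain.\<close>
  have half: "pmf (bernoulli_pmf (bias p 0)) b = 1 / 2" "pmf (bernoulli_pmf (bias p (Suc 0))) b = 1 / 2" for b
    unfolding bias_def by simp_all
  have "seqs.prefix_prob x (0 + 2) = 1 / 4"
    unfolding prefix_prob_eq[OF x] add_0 numeral_2_eq_2 prod.lessThan_Suc half by simp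
  then have "ln (seqs.prefix_prob x (0 + 2)) = - 2 * ln 2"
    using ln_realpow[of 2 2] by (simp only:) (simp add: ln_div)
  then show ?case
    by (simp only:) (simp add: squarefree_count_def)
next
  case (Suc N)
  let ?n = "Suc N"
  define z where "z = moebius_mu ?n * x ?n * x (?n + 1)"
  have "ln (pmf (bernoulli_pmf (bias p (Suc ?n))) (encode x (Suc ?n))) =
    - ln 2 + (ln 2 + (ln p + ln (1 - p)) / 2) * (if squarefree ?n then 1 else 0)
    + (ln p - ln (1 - p)) / 2 * real_of_int z"
  proof (cases "squarefree ?n")
    case True
    \<comment> \<open>The half sum plus \<open>z\<close> times the half difference of the two
      logarithms is \<open>ln p\<close> for \<open>z = 1\<close> and \<open>ln (1 - p)\<close> for
      \<open>z = - 1\<close>.\<close>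
    have "z = 1 \<or> z = - 1"
      using moebius_mu_squarefree[OF True] sign_seqs_cases[OF x, of ?n] sign_seqs_cases[OF x, of "?n + 1"]
      unfolding z_def by (elim disjE) simp_all
    moreover have "encode x (Suc ?n) \<longleftrightarrow> z = 1"
      using True by (simp add: z_def mult_ac)
    moreover have "bias p (Suc ?n) = p"
      using True by (simp add: bias_def)
    ultimately show ?thesis
      using p True by (elim disjE) (simp_all del: encode.simps add: field_simps)
  next
    case False
    have half: "pmf (bernoulli_pmf (bias p (Suc ?n))) b = 1 / 2" for b
      unfolding bias_def using False by simp
    have "z = 0"
      using False by (simp add: z_def moebius_mu_not_squarefree)
    then show ?thesis
      unfolding half using False by (simp add: ln_div)
  qed
  moreover have "seqs.prefix_prob x (?n + 2) =
      seqs.prefix_prob x (N + 2) * pmf (bernoulli_pmf (bias p (Suc ?n))) (encode x (Suc ?n))"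
    unfolding prefix_prob_eq[OF x] by (simp del: encode.simps)
  then have "ln (seqs.prefix_prob x (?n + 2)) =
      ln (seqs.prefix_prob x (N + 2)) + ln (pmf (bernoulli_pmf (bias p (Suc ?n))) (encode x (Suc ?n)))"
    by (simp only: ln_mult_pos[OF prefix_prob_pos[OF x] pmf_bias_pos])
  moreover have "real_of_int (\<Sum>n=1..?n. moebius_mu n * x n * x (n + 1)) =
      real_of_int (\<Sum>n=1..N. moebius_mu n * x n * x (n + 1)) + real_of_int z"
    by (simp add: z_def)
  moreover have "real (squarefree_count ?n) = real (squarefree_count N) + (if squarefree ?n then 1 else 0)"
    by (simp add: squarefree_count_Suc)
  moreover have "real (?n + 2) = real (N + 2) + 1"
    by simp
  ultimately show ?case
    using Suc.IH by (simp only: distrib_left)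
qed

text \<open>After division by the prefix length, the count in \<open>ln_prefix_prob\<close>
  contributes the squarefree density and the sum contributes \<alpha>, so the limit is the same at
  every point of the level set.\<close>

lemma tendsto_ln_prefix_prob:
  assumes x: "x \<in> moebius_level_set \<alpha>"
  shows "(\<lambda>n. ln (seqs.prefix_prob x n) / real n) \<longlonglongrightarrow>
    - ln 2 + (ln 2 + (ln p + ln (1 - p)) / 2) * (6 / pi\<^sup>2) + (ln p - ln (1 - p)) / 2 * \<alpha>"
proof -
  let ?A = "ln 2 + (ln p + ln (1 - p)) / 2" and ?B = "(ln p - ln (1 - p)) / 2"
  let ?S = "\<lambda>N. real_of_int (\<Sum>n=1..N. moebius_mu n * x n * x (n + 1))"
  have xs: "x \<in> sign_seqs" and S: "(\<lambda>N. 1 / real N * ?S N) \<longlonglongrightarrow> \<alpha>"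
    using x by (simp_all add: moebius_level_set_def)
  \<comment> \<open>This ratio converts averages over \<open>N\<close> into averages over the prefix
    length \<open>N + 2\<close>.\<close>
  have r: "(\<lambda>N. real N / real (N + 2)) \<longlonglongrightarrow> 1"
  proof -
    have "(\<lambda>N. 1 - 2 * (1 / real (N + 2))) \<longlonglongrightarrow> 1 - 2 * 0"
      by (intro tendsto_diff tendsto_mult tendsto_const LIMSEQ_ignore_initial_segment lim_1_over_n)
    moreover have "1 - 2 * (1 / real (N + 2)) = real N / real (N + 2)" for N
      by (simp add: field_simps)
    ultimately show ?thesis
      by simp
  qed
  have "(\<lambda>N. - ln 2 + ?A * (real (squarefree_count N) / real N * (real N / real (N + 2)))
      + ?B * (1 / real N * ?S N * (real N / real (N + 2))))
      \<longlonglongrightarrow> - ln 2 + ?A * (6 / pi\<^sup>2 * 1) + ?B * (\<alpha> * 1)"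
    by (rule tendsto_add[OF tendsto_add[OF tendsto_const tendsto_mult[OF tendsto_const
          tendsto_mult[OF squarefree_density r]]] tendsto_mult[OF tendsto_const tendsto_mult[OF S r]]])
  moreover have "eventually (\<lambda>N. - ln 2 + ?A * (real (squarefree_count N) / real N * (real N / real (N + 2)))
      + ?B * (1 / real N * ?S N * (real N / real (N + 2)))
      = ln (seqs.prefix_prob x (N + 2)) / real (N + 2)) sequentially"
    using eventually_gt_at_top[of 0]
  proof eventually_elim
    case (elim N)
    then have "real (squarefree_count N) / real N * (real N / real (N + 2)) = real (squarefree_count N) / real (N + 2)"
        "1 / real N * ?S N * (real N / real (N + 2)) = ?S N / real (N + 2)"
        "- ln 2 * real (N + 2) / real (N + 2) = - ln 2"
      by simp_all
    then show ?case
      unfolding ln_prefix_prob[OF xs] add_divide_distrib by (simp only: times_divide_eq_right)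
  qed
  ultimately have "(\<lambda>N. ln (seqs.prefix_prob x (N + 2)) / real (N + 2)) \<longlonglongrightarrow>
      - ln 2 + ?A * (6 / pi\<^sup>2 * 1) + ?B * (\<alpha> * 1)"
    by (rule Lim_transform_eventually)
  then have "(\<lambda>N. ln (seqs.prefix_prob x (N + 2)) / real (N + 2)) \<longlonglongrightarrow>
      - ln 2 + ?A * (6 / pi\<^sup>2) + ?B * \<alpha>"
    by (simp only: mult_1_right)
  then show ?thesis
    by (rule LIMSEQ_offset)
qed

section \<open>Law of large numbers along the squarefree numbers\<close>

lemma indep_coins:
  "coins.indep_vars (\<lambda>i. measure_pmf (bernoulli_pmf (bias p i))) (\<lambda>i w. w i) UNIV"
  by (subst coins.indep_vars_iff_distr_eq_PiM')
    (simp_all add: coins.PiM_component restrict_UNIV distr_id)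

text \<open>For \<open>i > 0\<close> this is the term of index \<open>i - 1\<close> in the sum for
  \<open>decode w\<close>, by \<open>moebius_mu_mult_decode\<close>; as a function of a single coin
  it inherits independence.\<close>

definition coin_sign :: "nat \<Rightarrow> (nat \<Rightarrow> bool) \<Rightarrow> real" where
  "coin_sign i w = (if squarefree (i - 1) then real_of_int (sign_of (w i)) else 0)"

lemma expectation_coin_sign:
  assumes "i > 0"
  shows "integral\<^sup>L (coin_measure p) (coin_sign i) = (if squarefree (i - 1) then 2 * p - 1 else 0)"
proof (cases "squarefree (i - 1)")
  case True
  have "coin_sign i = (\<lambda>w. real_of_int (sign_of (w i)))"
    using True by (simp add: coin_sign_def fun_eq_iff)
  then have "integral\<^sup>L (coin_measure p) (coin_sign i) =
      integral\<^sup>L (distr (coin_measure p) (measure_pmf (bernoulli_pmf (bias p i))) (\<lambda>w. w i))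
        (\<lambda>b. real_of_int (sign_of b))"
    unfolding coin_measure_def by (subst integral_distr) simp_all
  also have "\<dots> = integral\<^sup>L (measure_pmf (bernoulli_pmf (bias p i))) (\<lambda>b. real_of_int (sign_of b))"
    by (simp add: coin_measure_def coins.PiM_component)
  also have "\<dots> = 2 * p - 1"
    using True assms p by (simp add: bias_def sign_of_def)
  finally show ?thesis
    using True by simp
qed (simp add: coin_sign_def[abs_def])

text \<open>Hoeffding's inequality for \<open>N\<close> independent variables with values in
  [-1, 1]: the sum of the squared widths is \<open>4 * N\<close>. The bound is geometric in
  \<open>N\<close>, hence summable.\<close>

lemma coin_sign_deviation:
  assumes "\<epsilon> > 0"
  shows "measure (coin_measure p) {w \<in> space (coin_measure p).
    \<epsilon> * real N \<le> \<bar>(\<Sum>i=2..Suc N. coin_sign i w) - (2 * p - 1) * real (squarefree_count N)\<bar>} \<le>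
    2 * exp (- (\<epsilon>\<^sup>2 / 2)) ^ N"
\<comment> \<open>Hoeffding's inequality is applied with a positive sum of squared widths, so
  \<open>N = 0\<close> is separate.\<close>
proof (cases "N = 0")
  case True
  show ?thesis
    unfolding True power_0 by (rule order_trans[OF seqs.prob_le_1]) simp
next
  case False
  interpret Hoeffding_ineq "coin_measure p" "{2..Suc N}" coin_sign "\<lambda>_. - 1" "\<lambda>_. 1"
    "\<Sum>i=2..Suc N. integral\<^sup>L (coin_measure p) (coin_sign i)"
  proof unfold_locales
    have "coins.indep_vars (\<lambda>_. borel) (\<lambda>i w. coin_sign i w) UNIV"
      unfolding coin_sign_def
      by (rule coins.indep_vars_compose2[OF indep_coins, of "\<lambda>i b. if squarefree (i - 1) then real_of_int (sign_of b) else 0"])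
        simp
    then show "seqs.indep_vars (\<lambda>_. borel) coin_sign {2..Suc N}"
      unfolding coin_measure_def using coins.indep_vars_subset by blast
  qed (auto simp: coin_sign_def sign_of_def)
  have "(\<Sum>i=2..Suc N. integral\<^sup>L (coin_measure p) (coin_sign i)) =
      (\<Sum>i=2..Suc N. (2 * p - 1) * (if squarefree (i - 1) then 1 else 0))"
    by (rule sum.cong) (simp_all add: expectation_coin_sign)
  also have "\<dots> = (2 * p - 1) * (\<Sum>n=1..N. if squarefree n then 1 else 0)"
    by (simp add: sum_distrib_left numeral_2_eq_2 sum.shift_bounds_cl_Suc_ivl del: sum.cl_ivl_Suc)
  finally have mean: "(\<Sum>i=2..Suc N. integral\<^sup>L (coin_measure p) (coin_sign i)) =
      (2 * p - 1) * real (squarefree_count N)"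
    unfolding real_squarefree_count .
  have "- 2 * (\<epsilon> * real N)\<^sup>2 / (\<Sum>i=2..Suc N. (1 - (- 1))\<^sup>2) = real N * (- (\<epsilon>\<^sup>2 / 2))"
    using False by (simp add: power2_eq_square field_simps)
  then have bound: "exp (- 2 * (\<epsilon> * real N)\<^sup>2 / (\<Sum>i=2..Suc N. (1 - (- 1))\<^sup>2)) = exp (- (\<epsilon>\<^sup>2 / 2)) ^ N"
    by (simp only: exp_of_nat_mult)
  have "0 \<le> \<epsilon> * real N" "0 < (\<Sum>i=2..Suc N. (1 - (- 1 :: real))\<^sup>2)"
    using assms False by simp_all
  from Hoeffding_ineq_abs_ge[OF this] show ?thesis
    unfolding bound mean .
qed

text \<open>By Borel-Cantelli the deviation \<open>D N w\<close> is almost surely o(N). The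
  subtracted mean is \<open>2 * p - 1\<close> times the squarefree count, whose density yields the
  level.\<close>

lemma AE_decode_in_level_set: "AE w in coin_measure p. decode w \<in> moebius_level_set (6 / pi\<^sup>2 * (2 * p - 1))"
proof -
  define D where "D = (\<lambda>N w. (\<Sum>i=2..Suc N. coin_sign i w) - (2 * p - 1) * real (squarefree_count N))"
  have [measurable]: "coin_sign i \<in> borel_measurable (coin_measure p)" for i
    unfolding coin_measure_def coin_sign_def by measurable
  have "AE w in coin_measure p. eventually (\<lambda>N. \<bar>D N w\<bar> < \<epsilon> * real N) sequentially" if "\<epsilon> > 0" for \<epsilon>
  proof -
    have "AE w in coin_measure p. eventually (\<lambda>N. w \<in> space (coin_measure p) -
        {w \<in> space (coin_measure p). \<epsilon> * real N \<le> \<bar>D N w\<bar>}) sequentially"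
    proof (rule borel_cantelli_AE1)
      show "summable (\<lambda>N. measure (coin_measure p) {w \<in> space (coin_measure p). \<epsilon> * real N \<le> \<bar>D N w\<bar>})"
      proof (rule summable_comparison_test')
        show "summable (\<lambda>N. 2 * exp (- (\<epsilon>\<^sup>2 / 2)) ^ N)"
          using that by (intro summable_mult summable_geometric) simp
        show "norm (measure (coin_measure p) {w \<in> space (coin_measure p). \<epsilon> * real N \<le> \<bar>D N w\<bar>})
            \<le> 2 * exp (- (\<epsilon>\<^sup>2 / 2)) ^ N" for N
          using coin_sign_deviation[OF that] by (simp add: D_def)
      qed
    qed (simp_all add: D_def seqs.emeasure_eq_measure)
    then show ?thesis
      by eventually_elim (auto elim!: eventually_mono simp: not_le)
  qed
  \<comment> \<open>Countably many tolerances tending to 0 share one exceptional null set.\<close>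
  then have "AE w in coin_measure p. \<forall>j. eventually (\<lambda>N. \<bar>D N w\<bar> < inverse (real (Suc j)) * real N) sequentially"
    by (subst AE_all_countable) simp
  then show ?thesis
  proof eventually_elim
    case (elim w)
    have "(\<lambda>N. D N w / real N) \<longlonglongrightarrow> 0"
    proof (rule tendstoI)
      fix \<epsilon> :: real assume "\<epsilon> > 0"
      then obtain j where j: "inverse (real (Suc j)) < \<epsilon>"
        using reals_Archimedean by blast
      show "eventually (\<lambda>N. dist (D N w / real N) 0 < \<epsilon>) sequentially"
        using elim[rule_format, of j] eventually_gt_at_top[of 0]
      proof eventually_elim
        case (elim N)
        then have "\<bar>D N w\<bar> / real N < inverse (real (Suc j))"
          by (simp add: pos_divide_less_eq)
        then have "\<bar>D N w\<bar> / real N < \<epsilon>"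
          using j by linarith
        then show ?case
          by simp
      qed
    qed
    then have "(\<lambda>N. D N w / real N + (2 * p - 1) * (real (squarefree_count N) / real N))
        \<longlonglongrightarrow> 0 + (2 * p - 1) * (6 / pi\<^sup>2)"
      by (intro tendsto_add tendsto_mult tendsto_const squarefree_density)
    also have "(\<lambda>N. D N w / real N + (2 * p - 1) * (real (squarefree_count N) / real N)) =
        (\<lambda>N. 1 / real N * real_of_int (\<Sum>n=1..N. moebius_mu n * decode w n * decode w (n + 1)))"
    proof
      fix N
      have "real_of_int (\<Sum>n=1..N. moebius_mu n * decode w n * decode w (n + 1)) =
          (\<Sum>n=1..N. coin_sign (Suc n) w)"
        by (simp add: moebius_mu_mult_decode coin_sign_def del: decode.simps) (intro sum.cong, auto)
      also have "\<dots> = (\<Sum>i=2..Suc N. coin_sign i w)"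
        by (simp add: numeral_2_eq_2 sum.shift_bounds_cl_Suc_ivl del: sum.cl_ivl_Suc)
      finally show "D N w / real N + (2 * p - 1) * (real (squarefree_count N) / real N) =
          1 / real N * real_of_int (\<Sum>n=1..N. moebius_mu n * decode w n * decode w (n + 1))"
        by (simp add: D_def diff_divide_distrib)
    qed
    finally show ?case
      using decode_in_sign_seqs by (simp add: moebius_level_set_def mult.commute)
  qed
qed

end

section \<open>The value of the dimension\<close>

lemma binary_entropy_nonneg:
  assumes "0 < p" "p < 1"
  shows "0 \<le> binary_entropy p"
proof -
  have "p * ln p \<le> 0"
    by (rule mult_nonneg_nonpos) (use assms in simp_all)
  moreover have "(1 - p) * ln (1 - p) \<le> 0"
    by (rule mult_nonneg_nonpos) (use assms in simp_all)
  ultimately show ?thesis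
    unfolding binary_entropy_def by linarith
qed

theorem theorem1p6:
  fixes \<alpha> :: real
  assumes "\<alpha> \<in> {- 6 / pi\<^sup>2 <..< 6 / pi\<^sup>2}"
  shows "Metric_space.hausdorff_dim sign_seqs seq_dist (moebius_level_set \<alpha>) =
    ereal (1 - 6 / pi\<^sup>2 + 6 / (pi\<^sup>2 * ln 2) * binary_entropy (1 / 2 + pi\<^sup>2 / 12 * \<alpha>))"
proof -
  \<comment> \<open>This is the bias whose almost sure level is \<alpha>; the admissible range of
    \<alpha> corresponds exactly to \<open>0 < p < 1\<close>.\<close>
  define p where "p = 1 / 2 + pi\<^sup>2 / 12 * \<alpha>"
  have p: "0 < p" "p < 1"
    using assms by (simp_all add: p_def field_simps)
  have \<alpha>: "\<alpha> = 6 / pi\<^sup>2 * (2 * p - 1)"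
    by (simp add: p_def field_simps)
  let ?c = "1 - 6 / pi\<^sup>2 + 6 / (pi\<^sup>2 * ln 2) * binary_entropy p"
  interpret random_sign_seq "coin_measure p" decode
    by (rule random_sign_seq_decode[OF p])
  have "6 \<le> pi\<^sup>2"
    using sum_inverse_squares_bounds(2)[of 1] by simp
  then have c: "0 \<le> ?c"
    using binary_entropy_nonneg[OF p] by simp
  define D where "D = 6 / pi\<^sup>2"
  have "6 / (pi\<^sup>2 * ln 2) = D / ln 2"
    by (simp add: D_def)
  then have "?c * ln 2 = ln 2 - D * ln 2 + D * binary_entropy p"
    unfolding D_def[symmetric] by (simp add: algebra_simps)
  \<comment> \<open>With \<open>\<alpha> = D * (2 * p - 1)\<close> the coefficients of
    \<open>ln p\<close> and \<open>ln (1 - p)\<close> combine to \<open>D * p\<close> and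
    \<open>D * (1 - p)\<close>, which is \<open>- D\<close> times the entropy.\<close>
  then have rate: "- ln 2 + (ln 2 + (ln p + ln (1 - p)) / 2) * (6 / pi\<^sup>2) + (ln p - ln (1 - p)) / 2 * \<alpha> = - (?c * ln 2)"
    unfolding \<alpha> D_def[symmetric] by (simp add: binary_entropy_def field_simps)
  show ?thesis
    unfolding p_def[symmetric]
  proof (rule hausdorff_dim_eq_local_dim)
    show sub: "moebius_level_set \<alpha> \<subseteq> sign_seqs"
      by (auto simp: moebius_level_set_def)
    show "AE w in coin_measure p. decode w \<in> moebius_level_set \<alpha>"
      unfolding \<alpha> by (rule AE_decode_in_level_set[OF p])
    show "0 \<le> ?c"
      by (rule c)
    show "prefix_prob x n > 0" if "x \<in> moebius_level_set \<alpha>" for x n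
      using prefix_prob_pos[OF p] that sub by blast
    show "(\<lambda>n. ln (prefix_prob x n) / real n) \<longlonglongrightarrow> - (?c * ln 2)" if "x \<in> moebius_level_set \<alpha>" for x
      using tendsto_ln_prefix_prob[OF p that] unfolding rate .
  qed
qed

end
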